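(* Let $n>d$, let $X\in\mathbb{R}^{n\times d}$ have full rank, and suppose $X$, $y\in\mathbb{R}^n$, $\epsilon\in\mathbb{R}^n$, $\beta^*\in\mathbb{R}^d$ and $P^*\in\Pi_n$ satisfy $P^*y=X\beta^*+\epsilon$ with $\mathrm{dist}(P^*,I_n)\le r$. Suppose the following hold. (A1) There exist constants $U>L>0$ such that $\max_{i,j\in[n]}|y_i-y_j|\le U$ and $|(P^*y)_i-y_i|\ge L$ for all $i\in\mathrm{supp}(P^* )$. (A2) $R=10C_1rU^2/L^2+4$ for some constant $C_1>1$. (A3) There is a constant $\rho_n=O(d\log(n)/n)$ (i.e. $\rho_n\le C\,d\log(n)/n$ for a universal constant $C$) such that $R\rho_n\le L^2/(90U^2)$, $\|Hu\|^2\le\rho_n\|u\|^2$ for all $u\in\mathcal{B}_4$, and $\|Hu\|^2\le R\rho_n\|u\|^2$ for all $u\in\mathcal{B}_{2R}$. (A4) There is a constant $\bar\sigma\ge 0$ satisfying $\bar\sigma\le\min\{0.5,(\rho_nd)^{-1/2}\}\,L^2/(80U)$ such that $\|\widetilde H\epsilon\|_\infty\le\bar\sigma$, $\|\epsilon\|_\infty\le\bar\sigma$ and $\|H\epsilon\|\le\sqrt d\,\bar\sigma$. (B1) $R^2\rho_n\le 1/10$. (B2) There is a constant $\sigma\ge 0$ such that $\bar\sigma^2\le\sigma^2\min\{n/(660R^2),\,n/(5dR)\}$ and $\|\widetilde H\epsilon\|^2\ge\frac12 n\sigma^2$. Let $\{P^{(k)}\}_{k\ge 0}$ be the permutation matrices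 generated by the local search algorithm with parameter $R$. Given any $c>0$, define $$K^\dagger:=\left\lceil\log\Big(\frac{36\|\widetilde H\epsilon\|^2}{\|\widetilde HP^{(0)}y\|^2}\Big)\Big/\log\Big(1-\frac1{18R}\Big)+\frac{72n}{c}\right\rceil+1 .$$ Then there exists $0\le k\le K^\dagger$ such that $G(P^{(k)})\le c\,\bar\sigma^2$.
   Context: $\Pi_n$ is the set of $n\times n$ permutation matrices; for $P\in\Pi_n$, $\pi_P$ is the permutation of $[n]=\{1,\dots,n\}$ with $\pi_P(i)=j$ iff $P_{ij}=1$ (so $(Py)_i=y_{\pi_P(i)}$). $\mathrm{dist}(P,Q)=\#\{i\in[n]:\pi_P(i)\ne\pi_Q(i)\}$ and $\mathrm{supp}(P)=\{i\in[n]:\pi_P(i)\ne i\}$. $\|\cdot\|$ is the Euclidean norm and $\|\cdot\|_\infty$ the $\ell_\infty$-norm. $\mathcal{B}_m$ is the set of vectors in $\mathbb{R}^n$ with at most $m$ nonzero entries. $H=X(X^\top X)^{-1}X^\top$ and $\widetilde H=I_n-H$. Local search algorithm with parameter $R$: $P^{(0)}=I_n$ and, for $k=0,1,2,\dots$, $P^{(k+1)}$ is any element of $$\operatorname{argmin}\{\|\widetilde HPy\|^2:\ P\in\Pi_n,\ \mathrm{dist}(P,P^{(k)})\le 2,\ \mathrm{dist}(P,I_n)\le R\}.$$ (In practice the algorithm is also given a tolerance and a maximum number of iterations at which it stops and outputs the current iterate; $\{P^{(k)}\}_{k\ge0}$ denotes the sequence produced by the update above.) For $Q\in\Pi_n$,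 $G(Q):=\|\widetilde HQy\|^2-\min\{\|\widetilde HPy\|^2:\ P\in\Pi_n,\ \mathrm{dist}(P,Q)\le 2,\ \mathrm{dist}(P,I_n)\le R\}$.
   Formalization: In K† the quotient of logarithms is replaced by its positive part, since for a negative quotient the printed claim fails (e.g. P* = I and c large make K† negative); if H̃ε = 0, where log 0 occurs, K† is read as +∞. *)

theory Defs
  imports "HOL-Analysis.Analysis" "HOL-Library.Extended_Nat"
begin

text \<open>The finite index type \<open>'n\<close> plays the role of \<open>[n]\<close>, with \<open>n = CARD('n)\<close>.\<close>

definition perm_mats :: "(real^'n^'n) set" where
  "perm_mats = {P. (\<forall>i j. P $ i $ j = 0 \<or> P $ i $ j = 1) \<and>
                   (\<forall>i. \<exists>!j. P $ i $ j = 1) \<and> (\<forall>j. \<exists>!i. P $ i $ j = 1)}"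

text \<open>Meaningful for \<open>P \<in> perm_mats\<close> only.\<close>

definition perm_of :: "real^'n^'n \<Rightarrow> 'n \<Rightarrow> 'n" where
  "perm_of P i = (THE j. P $ i $ j = 1)"

definition pdist :: "real^'n^'n \<Rightarrow> real^'n^'n \<Rightarrow> nat" where
  "pdist P Q = card {i. perm_of P i \<noteq> perm_of Q i}"

definition psupp :: "real^'n^'n \<Rightarrow> 'n set" where
  "psupp P = {i. perm_of P i \<noteq> i}"

text \<open>The sparsity level \<open>m\<close> is real, since it is used at \<open>m = 2 * R\<close> with \<open>R\<close> real.\<close>

definition sparse_vecs :: "real \<Rightarrow> (real^'n) set" where
  "sparse_vecs m = {u. real (card {i. u $ i \<noteq> 0}) \<le> m}"

definition hat_mat :: "real^'d^'n \<Rightarrow> real^'n^'n" where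
  "hat_mat X = X ** matrix_inv (transpose X ** X) ** transpose X"

definition resid_mat :: "real^'d^'n \<Rightarrow> real^'n^'n" where
  "resid_mat X = mat 1 - hat_mat X"

definition objective :: "real^'d^'n \<Rightarrow> real^'n \<Rightarrow> real^'n^'n \<Rightarrow> real" where
  "objective X y P = (norm (resid_mat X *v (P *v y)))\<^sup>2"

definition feasible :: "real \<Rightarrow> real^'n^'n \<Rightarrow> (real^'n^'n) set" where
  "feasible R Q = {P \<in> perm_mats. pdist P Q \<le> 2 \<and> real (pdist P (mat 1)) \<le> R}"

text \<open>Every step may pick an arbitrary minimiser, so this is a predicate on sequences of iterates.\<close>

definition local_search_seq ::
  "real^'d^'n \<Rightarrow> real^'n \<Rightarrow> real \<Rightarrow> (nat \<Rightarrow> real^'n^'n) \<Rightarrow> bool" where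
  "local_search_seq X y R P \<longleftrightarrow>
     P 0 = mat 1 \<and>
     (\<forall>k. is_arg_min (objective X y) (\<lambda>Q. Q \<in> feasible R (P k)) (P (Suc k)))"

definition gap :: "real^'d^'n \<Rightarrow> real^'n \<Rightarrow> real \<Rightarrow> real^'n^'n \<Rightarrow> real" where
  "gap X y R Q = objective X y Q - Min (objective X y ` feasible R Q)"

text \<open>
  The iteration count
  \<open>\<lceil>log (36 \<parallel>resid \<epsilon>\<parallel>\<^sup>2 / \<parallel>resid P\<^sub>0 y\<parallel>\<^sup>2) / log (1 - 1/(18 R)) + 72 n / c\<rceil> + 1\<close>.
  Two conventions are needed to make it a meaningful iteration count:
  \<^item> The quotient of logarithms is the number of iterations of the linearly convergent phase,
    bringing the objective from \<open>\<parallel>resid P\<^sub>0 y\<parallel>\<^sup>2\<close> down to \<open>36 \<parallel>resid \<epsilon>\<parallel>\<^sup>2\<close>. It is negative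
    when the start is already below that level; the phase is then empty and counts as \<open>0\<close>.
    (Subtracting iterations instead could make the whole count negative.)
  \<^item> If \<open>resid \<epsilon> = 0\<close>, the numerator is \<open>log 0 = -\<infinity>\<close> and the count is infinite.
  If only \<open>resid P\<^sub>0 y\<close> vanishes, HOL's \<open>x / 0 = 0\<close> and \<open>ln 0 = 0\<close> make the quotient \<open>0\<close>, which
  agrees with the first convention applied to \<open>+\<infinity>\<close> over a negative number.
\<close>

definition K_dagger ::
  "real^'d^'n \<Rightarrow> real^'n \<Rightarrow> real^'n \<Rightarrow> real^'n^'n \<Rightarrow> real \<Rightarrow> real \<Rightarrow> enat" where
  "K_dagger X y e P0 R c =
     (if resid_mat X *v e = 0 then \<infinity>
      else enat (nat (\<lceil>max 0 (ln (36 * (norm (resid_mat X *v e))\<^sup>2 /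
                                    (norm (resid_mat X *v (P0 *v y)))\<^sup>2) /
                             ln (1 - 1 / (18 * R)))
                      + 72 * real CARD('n) / c\<rceil> + 1)))"

end

theory Submission
  imports Defs
begin

text \<open>
  Write \<open>err P = P *v y - Pstar *v y\<close>, so that the objective at \<open>P\<close> is
  \<open>\<parallel>resid (err P + \<epsilon>)\<parallel>\<^sup>2\<close>. If \<open>M\<close> is the largest modulus of an entry of \<open>err P\<close>, a counting
  argument yields a transposition lowering \<open>\<parallel>err P\<parallel>\<^sup>2\<close> by at least \<open>M\<^sup>2 / 2\<close>, and for moves of
  distance at most \<open>2\<close> the change of the objective differs from the change of \<open>\<parallel>err P\<parallel>\<^sup>2\<close> only
  by a small amount.

  The constraint at radius \<open>R\<close> never blocks this transposition: while \<open>M \<ge> L\<close> each step lowers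
  \<open>\<parallel>err P\<parallel>\<^sup>2\<close> by a fixed multiple of \<open>L\<^sup>2\<close>, so this phase ends long before the radius is reached;
  once \<open>M < L\<close>, it stays so, the support of \<open>P\<close> contains that of \<open>Pstar\<close>, and swapping two wrong
  entries does not enlarge it. Since \<open>err P\<close> has at most \<open>11 R / 10\<close> nonzero entries,
  \<open>M\<^sup>2\<close> is at least a fraction of order \<open>1 / R\<close> of the objective as long as that dominates the noise;
  this gives the linear phase. Below \<open>36 \<parallel>resid \<epsilon>\<parallel>\<^sup>2 \<le> 36 n \<sigma>bar\<^sup>2\<close>, with \<open>\<sigma>bar\<close> the entrywise bound
  on \<open>resid \<epsilon>\<close>, steps that gain more than \<open>c \<sigma>bar\<^sup>2\<close> can only occur \<open>36 n / c\<close> times.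
  If \<open>resid \<epsilon> = 0\<close>, the iteration count is unbounded and finiteness of the set of permutations
  suffices.
\<close>

subsection \<open>Permutation matrices\<close>


lemma perm_mats_nth:
  assumes "P \<in> perm_mats"
  shows "P $ i $ j = (if j = perm_of P i then 1 else 0)"
proof -
  have ex1: "\<exists>!j. P $ i $ j = 1" and "P $ i $ j = 0 \<or> P $ i $ j = 1"
    using assms by (auto simp: perm_mats_def)
  moreover have "P $ i $ perm_of P i = 1"
    using theI'[OF ex1] by (simp add: perm_of_def)
  ultimately show ?thesis by auto
qed

lemma perm_mats_mult_nth: "P \<in> perm_mats \<Longrightarrow> (P *v y) $ i = y $ perm_of P i"
  by (simp add: matrix_vector_mult_def perm_mats_nth if_distribR sum.delta if_distrib cong: if_cong)

lemma bij_perm_of: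
  assumes "P \<in> perm_mats"
  shows "bij (perm_of P)"
proof -
  have "\<exists>!i. P $ i $ j = 1" for j
    using assms by (auto simp: perm_mats_def)
  then have "\<exists>!i. perm_of P i = j" for j
    by (simp add: perm_mats_nth[OF assms] if_split_eq1) (metis (no_types) zero_neq_one)
  then show ?thesis
    by (simp add: bij_iff)
qed

definition perm_mat :: "('n \<Rightarrow> 'n) \<Rightarrow> real^'n^'n" where
  "perm_mat p = (\<chi> i j. if j = p i then 1 else 0)"

lemma perm_of_perm_mat [simp]: "perm_of (perm_mat p) = p"
  by (auto simp: perm_of_def perm_mat_def fun_eq_iff)

lemma perm_mat_in_perm_mats:
  assumes "bij p"
  shows "perm_mat p \<in> perm_mats"
proof -
  have "\<exists>!i. j = p i" for j
    using assms by (metis bij_iff)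
  then show ?thesis
    by (auto simp: perm_mats_def perm_mat_def)
qed

lemma mat_1_eq_perm_mat: "mat 1 = perm_mat id"
  by (auto simp: mat_def perm_mat_def vec_eq_iff)

lemma inj_on_perm_of: "inj_on perm_of perm_mats"
  by (intro inj_onI) (auto simp: vec_eq_iff perm_mats_nth)

lemma finite_perm_mats: "finite (perm_mats :: (real^'n^'n) set)"
  using inj_on_perm_of finite_imageD[of perm_of "perm_mats :: (real^'n^'n) set"] by simp

lemma pdist_triangle: "pdist P Q \<le> pdist P S + pdist S Q"
proof -
  have "pdist P Q \<le> card ({i. perm_of P i \<noteq> perm_of S i} \<union> {i. perm_of S i \<noteq> perm_of Q i})"
    unfolding pdist_def by (intro card_mono) auto
  also have "\<dots> \<le> pdist P S + pdist S Q"
    unfolding pdist_def by (rule card_Un_le)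
  finally show ?thesis .
qed

lemma pdist_commute: "pdist P Q = pdist Q P"
  by (simp add: pdist_def eq_commute)

lemma pdist_mat_1: "pdist P (mat 1) = card (psupp P)"
  by (simp add: pdist_def psupp_def mat_1_eq_perm_mat)

subsection \<open>The hat matrix\<close>

lemma inner_matrix_vector_mult:
  fixes A :: "real^'m^'n"
  shows "(A *v x) \<bullet> y = x \<bullet> (transpose A *v y)"
  by (metis dot_lmul_matrix vector_transpose_matrix)

text \<open>Full column rank makes the Gram matrix injective, hence invertible, so the choice behind
  \<open>matrix_inv\<close> yields a two-sided inverse and the projection identities become pure
  algebra.\<close>

lemma
  fixes X :: "real^'d^'n"
  assumes "rank X = CARD('d)"
  shows transpose_hat_mat: "transpose (hat_mat X) = hat_mat X"
    and hat_mat_idem: "hat_mat X ** hat_mat X = hat_mat X"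
    and hat_mat_mult: "hat_mat X ** X = X"
proof -
  define A where "A = transpose X ** X"
  have "v = 0" if "A *v v = 0" for v
  proof -
    have "(X *v v) \<bullet> (X *v v) = v \<bullet> (A *v v)"
      unfolding A_def matrix_vector_mul_assoc[symmetric] by (rule inner_matrix_vector_mult)
    then have "X *v v = 0" using that by simp
    then show "v = 0"
      using assms full_rank_injective[of X] by (metis injD matrix_vector_mult_0_right)
  qed
  then have "invertible A"
    using matrix_left_invertible_ker[of A] invertible_left_inverse[of A] by blast
  then have inv: "matrix_inv A ** A = mat 1" "A ** matrix_inv A = mat 1"
    using someI_ex[of "\<lambda>B. A ** B = mat 1 \<and> B ** A = mat 1"]
    unfolding invertible_def matrix_inv_def by auto
  have "transpose A = A"
    by (simp add: A_def matrix_transpose_mul)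
  then have "transpose (matrix_inv A) = matrix_inv A"
    by (metis inv matrix_mul_assoc matrix_mul_lid matrix_mul_rid matrix_transpose_mul transpose_mat)
  then show "transpose (hat_mat X) = hat_mat X"
    by (simp add: hat_mat_def A_def matrix_transpose_mul matrix_mul_assoc)
  have "hat_mat X ** X = X ** (matrix_inv A ** A)"
    by (simp add: hat_mat_def A_def matrix_mul_assoc)
  then show *: "hat_mat X ** X = X" by (simp add: inv)
  have "hat_mat X ** hat_mat X = (hat_mat X ** X) ** (matrix_inv A ** transpose X)"
    by (simp add: hat_mat_def A_def matrix_mul_assoc)
  then show "hat_mat X ** hat_mat X = hat_mat X"
    unfolding * by (simp add: hat_mat_def A_def matrix_mul_assoc)
qed

subsection \<open>Swaps and descent\<close>

text \<open>For \<open>i \<noteq> j\<close>, exchanging \<open>v i\<close> and \<open>v j\<close>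
  lowers the sum of squares of \<open>v - w\<close> by exactly
  \<open>2 * ((v i - v j) * (w j - w i))\<close>. That \<open>j\<close> is itself a wrong entry
  later keeps the exchange inside the support.\<close>

lemma swap_exists:
  fixes v w :: "'a::finite \<Rightarrow> real"
  assumes p: "bij p" "\<And>a. v a = w (p a)"
    and M: "\<And>a. \<bar>v a - w a\<bar> \<le> M" "\<bar>v i - w i\<bar> = M" "M > 0"
  obtains j where "v j \<noteq> w j" "M / 2 \<le> \<bar>v i - v j\<bar>"
    "\<bar>v i - v j\<bar> * M \<le> 2 * ((v i - v j) * (w j - w i))"
proof -
  have pos: "\<exists>j. v j \<noteq> w j \<and> M / 2 \<le> \<bar>v i - v j\<bar> \<and>
      \<bar>v i - v j\<bar> * M \<le> 2 * ((v i - v j) * (w j - w i))"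
    if p: "\<And>a. v a = w (p a)" and M1: "\<And>a. \<bar>v a - w a\<bar> \<le> M" and M2: "v i - w i = M"
    for v w :: "'a \<Rightarrow> real"
  proof -
    define h where "h = w i + M / 2"
    \<comment> \<open>Equally many entries of \<open>v\<close> and of \<open>w\<close> lie above the midpoint \<open>h\<close> of \<open>w i\<close> and \<open>v i\<close>.\<close>
    have "p ` {a. h \<le> v a} = {a. h \<le> w a}"
      using p \<open>bij p\<close> by (auto simp: image_iff) (metis bij_pointE)
    then have "card {a. h \<le> v a} = card {a. h \<le> w a}"
      by (metis \<open>bij p\<close> bij_is_inj card_image inj_on_subset subset_UNIV)
    moreover have "i \<in> {a. h \<le> v a} - {a. h \<le> w a}"
      using M2 \<open>M > 0\<close> by (auto simp: h_def)
    ultimately have "\<not> {a. h \<le> w a} \<subseteq> {a. h \<le> v a}"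
      by (metis DiffD1 DiffD2 card_subset_eq finite)
    then obtain j where j: "h \<le> w j" "v j < h" by (metis (mono_tags) mem_Collect_eq not_le subsetI)
    have "M / 2 \<le> w j - w i" "M / 2 \<le> v i - v j" "v j \<noteq> w j"
      using j M2 M1[of j] by (auto simp: h_def)
    moreover from this have "(v i - v j) * M \<le> 2 * ((v i - v j) * (w j - w i))"
      using \<open>M > 0\<close> mult_left_mono[of M "2 * (w j - w i)" "v i - v j"] by (simp add: algebra_simps)
    ultimately show ?thesis
      using \<open>M > 0\<close> by (intro exI[of _ j]) auto
  qed
  show ?thesis
  proof (cases "w i \<le> v i")
    case True
    then show ?thesis using pos[of v w] p M that by auto
  next
    case False
    \<comment> \<open>Negating both vectors reduces this to the case already treated and preserves
      the product.\<close>
    have "\<exists>j. - v j \<noteq> - w j \<and> M / 2 \<le> \<bar>- v i - - v j\<bar> \<and>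
      \<bar>- v i - - v j\<bar> * M \<le> 2 * ((- v i - - v j) * (- w j - - w i))"
      using False p M by (intro pos[of "\<lambda>a. - v a" "\<lambda>a. - w a"]) (auto simp: abs_minus_commute)
    then obtain j where j: "v j \<noteq> w j" "M / 2 \<le> \<bar>- v i - - v j\<bar>"
      "\<bar>- v i - - v j\<bar> * M \<le> 2 * ((- v i - - v j) * (- w j - - w i))" by auto
    moreover have "\<bar>- v i - - v j\<bar> = \<bar>v i - v j\<bar>"
      "(- v i - - v j) * (- w j - - w i) = (v i - v j) * (w j - w i)"
      by (auto simp: algebra_simps)
    ultimately show ?thesis using that by metis
  qed
qed

text \<open>If every step up to the bound gained more than \<open>c * s\<close>, contraction would
  bring \<open>F\<close> down to \<open>36 * E\<close> within \<open>a\<close> steps, and the next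
  \<open>m + 1\<close> steps would lose more than \<open>72 * N * s\<close>, although
  \<open>F\<close> stays nonnegative and \<open>36 * E \<le> 36 * N * s\<close>.\<close>

lemma descent_count:
  fixes F :: "nat \<Rightarrow> real"
  assumes nonneg: "\<And>k. F k \<ge> 0" and mono: "\<And>k. F (Suc k) \<le> F k"
    and E: "E > 0" "E \<le> N * s" and N: "N > 0" and c: "c > 0"
    and q: "0 < q" "q < 1" and lin: "\<And>k. F k \<ge> 36 * E \<Longrightarrow> F (Suc k) \<le> q * F k"
  shows "\<exists>k. k \<le> nat (\<lceil>max 0 (ln (36 * E / F 0) / ln q) + 72 * N / c\<rceil> + 1) \<and>
    F k - F (Suc k) \<le> c * s"
proof (rule ccontr)
  define T where "T = max 0 (ln (36 * E / F 0) / ln q)"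
  define a where "a = nat \<lceil>T\<rceil>"
  define m where "m = nat \<lfloor>72 * N / c\<rfloor>"
  assume "\<not> ?thesis"
  then have big: "F (Suc k) < F k - c * s" if "k \<le> nat (\<lceil>T + 72 * N / c\<rceil> + 1)" for k
    using that by (fold T_def) (metis leI less_diff_eq add.commute)
  have "T \<ge> 0" by (simp add: T_def)
  have antimono: "F k' \<le> F k" if "k \<le> k'" for k k'
    using mono that by (rule lift_Suc_antimono_le)
  have start: "F a \<le> 36 * E"
  proof (rule ccontr)
    assume "\<not> F a \<le> 36 * E"
    then have ge: "36 * E < F k" if "k \<le> a" for k
      using antimono[OF that] by linarith
    then have F0: "F 0 > 0" using E by (metis le0 less_trans mult_pos_pos zero_less_numeral)
    have "F k \<le> q ^ k * F 0" if "k \<le> a" for k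
      using that
    proof (induction k)
      case (Suc k)
      then have "F (Suc k) \<le> q * F k" using ge[of k] by (intro lin) auto
      also have "\<dots> \<le> q * (q ^ k * F 0)" using Suc q by (intro mult_left_mono) auto
      finally show ?case by simp
    qed simp
    then have "36 * E < q ^ a * F 0" using ge[of a] by (meson less_le_trans order_refl)
    then have "36 * E / F 0 < q ^ a" using F0 by (simp add: field_simps)
    then have "ln (36 * E / F 0) < ln (q ^ a)"
      using E F0 q by (subst ln_less_cancel_iff) auto
    then have "ln (36 * E / F 0) < a * ln q" using q by (simp add: ln_realpow)
    moreover have "ln q < 0" using q by simp
    ultimately have "a < ln (36 * E / F 0) / ln q" by (simp add: neg_less_divide_eq)
    moreover have "T \<le> a" unfolding a_def by linarith
    ultimately show False by (auto simp: T_def)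
  qed
  have "s > 0" using E \<open>N > 0\<close> by (metis less_le_trans zero_less_mult_pos)
  have "72 * N / c \<ge> 0" using c \<open>N > 0\<close> by simp
  \<comment> \<open>Rounding \<open>T\<close> up and the other summand down overshoots their sum by
    less than 1, so \<open>big\<close> covers every index \<open>a + j\<close> with
    \<open>j \<le> m\<close>.\<close>
  then have sum: "real (a + m) < T + 72 * N / c + 1"
    using \<open>T \<ge> 0\<close> unfolding a_def m_def by simp linarith
  have "F (Suc (a + j)) \<le> F a - real (Suc j) * (c * s)" if "j \<le> m" for j
    using that
  proof (induction j)
    case 0
    then show ?case using big[of a] sum by (simp add: le_nat_iff) linarith
  next
    case (Suc j)
    have "a + Suc j \<le> nat (\<lceil>T + 72 * N / c\<rceil> + 1)"
      using sum Suc.prems by linarith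
    then show ?case using big[of "a + Suc j"] Suc by (simp add: algebra_simps)
  qed
  from this[of m] have "real (Suc m) * (c * s) \<le> 36 * E"
    using nonneg[of "Suc (a + m)"] start by simp
  moreover have "72 * N < real (Suc m) * c"
  proof -
    have "72 * N / c < real (Suc m)" unfolding m_def by linarith
    then show ?thesis using c by (simp add: field_simps)
  qed
  then have "72 * N * s < real (Suc m) * (c * s)"
    using \<open>s > 0\<close> by (metis mult.assoc mult_strict_right_mono)
  ultimately show False using E by auto
qed


subsection \<open>Sparse vectors\<close>

lemma power2_norm_vec: "(norm (x :: real^'n))\<^sup>2 = (\<Sum>a\<in>UNIV. (x $ a)\<^sup>2)"
  unfolding power2_norm_eq_inner inner_vec_def by (simp add: power2_eq_square)

lemma power2_norm_le_card_support:
  fixes x :: "real^'n" and m :: real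
  assumes "\<And>a. \<bar>x $ a\<bar> \<le> m"
  shows "(norm x)\<^sup>2 \<le> card {a. x $ a \<noteq> 0} * m\<^sup>2"
proof -
  have "(norm x)\<^sup>2 = (\<Sum>a | x $ a \<noteq> 0. (x $ a)\<^sup>2)"
    unfolding power2_norm_vec by (rule sum.mono_neutral_right) auto
  also have "\<dots> \<le> card {a. x $ a \<noteq> 0} * m\<^sup>2"
    using assms by (intro sum_bounded_above) (metis abs_ge_zero power2_abs power_mono)
  finally show ?thesis .
qed

lemma abs_inner_le_card_support:
  fixes x w :: "real^'n" and m b :: real
  assumes "\<And>a. \<bar>x $ a\<bar> \<le> m" and "infnorm w \<le> b"
  shows "\<bar>x \<bullet> w\<bar> \<le> card {a. x $ a \<noteq> 0} * (m * b)"
proof -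
  have "m \<ge> 0" using assms(1) by (meson abs_ge_zero order_trans)
  have "x \<bullet> w = (\<Sum>a | x $ a \<noteq> 0. x $ a * w $ a)"
    unfolding inner_vec_def inner_real_def by (rule sum.mono_neutral_right) auto
  also have "\<bar>\<dots>\<bar> \<le> (\<Sum>a | x $ a \<noteq> 0. \<bar>x $ a * w $ a\<bar>)" by (rule sum_abs)
  also have "\<dots> \<le> card {a. x $ a \<noteq> 0} * (m * b)"
    using assms \<open>m \<ge> 0\<close> unfolding abs_mult
    by (intro sum_bounded_above mult_mono) (auto intro: order_trans[OF component_le_infnorm_cart])
  finally show ?thesis .
qed

lemma infnorm_attained_cart: "\<exists>a. \<bar>(x :: real^'n) $ a\<bar> = infnorm x"
proof -
  have "infnorm x = Max (range (\<lambda>a. \<bar>x $ a\<bar>))"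
    unfolding infnorm_cart by (subst cSup_eq_Max[symmetric]) (auto simp: full_SetCompr_eq)
  also have "\<dots> \<in> range (\<lambda>a. \<bar>x $ a\<bar>)" by (rule Max_in) auto
  finally show ?thesis by (metis imageE)
qed

subsection \<open>Local search for mismatched regression\<close>

text \<open>\<open>s\<close> plays the role of \<open>\<sigma>bar\<close>; the 160 in its bound is
  80 combined with the factor 1/2, and \<open>R_ge\<close> absorbs the constant
  \<open>C1\<close>.\<close>

locale mismatched_regression =
  fixes X :: "real^'d^'n" and y \<epsilon> :: "real^'n" and \<beta> :: "real^'d" and Pstar :: "real^'n^'n"
    and r :: nat and U L R \<rho> s :: real
  assumes full_rank: "rank X = CARD('d)"
    and Pstar: "Pstar \<in> perm_mats" "pdist Pstar (mat 1) \<le> r"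
    and model: "Pstar *v y = X *v \<beta> + \<epsilon>"
    and UL: "U > L" "L > 0"
    and y_range: "\<bar>y $ i - y $ j\<bar> \<le> U"
    and y_sep: "i \<in> psupp Pstar \<Longrightarrow> \<bar>(Pstar *v y) $ i - y $ i\<bar> \<ge> L"
    and R_ge: "R \<ge> 10 * real r * U\<^sup>2 / L\<^sup>2 + 4"
    and R_rho: "R * \<rho> \<le> L\<^sup>2 / (90 * U\<^sup>2)"
    and sparse4: "u \<in> sparse_vecs 4 \<Longrightarrow> (norm (hat_mat X *v u))\<^sup>2 \<le> \<rho> * (norm u)\<^sup>2"
    and sparse2R: "u \<in> sparse_vecs (2 * R) \<Longrightarrow> (norm (hat_mat X *v u))\<^sup>2 \<le> R * \<rho> * (norm u)\<^sup>2"
    and s: "s \<ge> 0" "s \<le> L\<^sup>2 / (160 * U)" "infnorm (resid_mat X *v \<epsilon>) \<le> s"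
begin

abbreviation "H \<equiv> hat_mat X"
abbreviation "Ht \<equiv> resid_mat X"
abbreviation "F \<equiv> objective X y"
abbreviation "E \<equiv> (norm (Ht *v \<epsilon>))\<^sup>2"

section \<open>The error vector and its support\<close>

definition err :: "real^'n^'n \<Rightarrow> real^'n" where
  "err P = P *v y - Pstar *v y"

definition admissible :: "real^'n^'n \<Rightarrow> bool" where
  "admissible P \<longleftrightarrow> P \<in> perm_mats \<and> real (pdist P (mat 1)) \<le> R"

lemma feasible_iff: "Q \<in> feasible R P \<longleftrightarrow> admissible Q \<and> pdist Q P \<le> 2"
  by (auto simp: feasible_def admissible_def)

lemma feasible_self: "admissible P \<Longrightarrow> P \<in> feasible R P"
  by (simp add: feasible_iff pdist_def)

lemma R_ge_4: "R \<ge> 4"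
  using R_ge by (smt (verit) UL divide_nonneg_nonneg mult_nonneg_nonneg of_nat_0_le_iff zero_le_power2)

lemma r_le: "real r \<le> R / 10"
proof -
  have "1 \<le> U\<^sup>2 / L\<^sup>2" using UL by (simp add: power_mono)
  then have "real r * 1 \<le> r * (U\<^sup>2 / L\<^sup>2)" by (intro mult_left_mono) auto
  then show ?thesis using R_ge by simp
qed

text \<open>Testing \<open>sparse4\<close> on a unit vector bounds \<open>\<rho>\<close> below by a
  square.\<close>

lemma rho_nonneg: "\<rho> \<ge> 0"
proof -
  have "axis undefined (1::real) \<in> (sparse_vecs 4 :: (real^'n) set)"
    using card_mono[of "{undefined}" "{i. axis undefined (1::real) $ i \<noteq> 0}"]
    by (auto simp: sparse_vecs_def axis_def)
  from sparse4[OF this] show ?thesis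
    by (simp add: order_trans[OF zero_le_power2])
qed

lemma err_nth: "P \<in> perm_mats \<Longrightarrow> err P $ a = y $ perm_of P a - y $ perm_of Pstar a"
  by (simp add: err_def perm_mats_mult_nth Pstar)

lemma abs_err_le: "P \<in> perm_mats \<Longrightarrow> \<bar>err P $ a\<bar> \<le> U"
  by (simp add: err_nth y_range)

text \<open>Both terms of the error are rearrangements of \<open>y\<close>. Hence a move preserves
  the total error, which ties together the two entries it touches.\<close>

lemma sum_err:
  assumes "P \<in> perm_mats"
  shows "(\<Sum>a\<in>UNIV. err P $ a) = 0"
proof -
  have "(\<Sum>a\<in>UNIV. y $ perm_of Q a) = (\<Sum>a\<in>UNIV. y $ a)" if "Q \<in> perm_mats" for Q
    using bij_perm_of[OF that] by (rule sum.reindex_bij_betw)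
  then show ?thesis using assms Pstar by (simp add: err_nth sum_subtractf)
qed

text \<open>\<open>P\<close> moves at most \<open>R\<close> points and \<open>Pstar\<close> at most
  \<open>R / 10\<close>. The result lies below \<open>2 * R\<close>, so \<open>sparse2R\<close>
  applies to the error.\<close>

lemma card_err_support:
  assumes "admissible P"
  shows "card {a. err P $ a \<noteq> 0} \<le> 11 / 10 * R"
proof -
  have "card {a. err P $ a \<noteq> 0} \<le> pdist P Pstar"
    using assms unfolding pdist_def by (intro card_mono) (auto simp: admissible_def err_nth)
  also have "\<dots> \<le> pdist P (mat 1) + r"
    using pdist_triangle[of P Pstar "mat 1"] Pstar(2) by (simp add: pdist_commute)
  finally show ?thesis using assms r_le by (simp add: admissible_def)
qed

lemma power2_norm_err_le:
  assumes "admissible P" "\<And>a. \<bar>err P $ a\<bar> \<le> m"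
  shows "(norm (err P))\<^sup>2 \<le> 11 / 10 * R * m\<^sup>2"
proof -
  have "(norm (err P))\<^sup>2 \<le> card {a. err P $ a \<noteq> 0} * m\<^sup>2"
    using assms by (intro power2_norm_le_card_support)
  also have "\<dots> \<le> 11 / 10 * R * m\<^sup>2"
    using card_err_support[OF assms(1)] by (intro mult_right_mono) auto
  finally show ?thesis .
qed

section \<open>Expansion of the objective by orthogonal projection\<close>

lemma H_inner: "(H *v x) \<bullet> w = x \<bullet> (H *v w)"
  by (simp add: inner_matrix_vector_mult transpose_hat_mat full_rank)

lemma H_H: "H *v (H *v x) = H *v x"
  by (simp add: matrix_vector_mul_assoc hat_mat_idem full_rank)

lemma Ht_eq: "Ht *v x = x - H *v x"
  by (simp add: resid_mat_def matrix_vector_mult_diff_rdistrib)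

lemma Ht_Ht_inner: "(Ht *v x) \<bullet> (Ht *v w) = x \<bullet> (Ht *v w)"
  by (simp add: Ht_eq inner_diff_left inner_diff_right H_inner H_H)

lemma objective_eq: "F P = (norm (Ht *v (err P + \<epsilon>)))\<^sup>2"
proof -
  have "Ht *v (X *v \<beta>) = 0"
    unfolding Ht_eq by (simp add: matrix_vector_mul_assoc hat_mat_mult full_rank)
  moreover have "P *v y = err P + \<epsilon> + X *v \<beta>"
    by (simp add: err_def model)
  ultimately show ?thesis
    by (simp add: objective_def matrix_vector_right_distrib)
qed

lemma objective_expand:
  "F P = (norm (err P))\<^sup>2 - (norm (H *v err P))\<^sup>2 + 2 * (err P \<bullet> (Ht *v \<epsilon>)) + E"
proof -
  have "F P = (Ht *v err P) \<bullet> (Ht *v err P) + 2 * ((Ht *v err P) \<bullet> (Ht *v \<epsilon>)) + E"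
    by (simp add: objective_eq matrix_vector_right_distrib power2_norm_eq_inner
        inner_add_left inner_add_right inner_commute)
  moreover have "(Ht *v err P) \<bullet> (Ht *v err P) = (norm (err P))\<^sup>2 - (norm (H *v err P))\<^sup>2"
    unfolding Ht_Ht_inner by (simp add: Ht_eq inner_diff_right power2_norm_eq_inner H_inner H_H)
  ultimately show ?thesis by (simp add: Ht_Ht_inner)
qed

text \<open>The difference \<open>u\<close> of the errors has at most two nonzero entries. The
  projection terms differ by an inner product of \<open>H *v u\<close>, controlled by
  \<open>sparse4\<close>, with the projected errors, controlled by \<open>sparse2R\<close>; the
  noise meets only the entries of \<open>u\<close>. The scale \<open>m\<close> is left free:
  \<open>U\<close> for crude bounds, the maximal error for the linear phase.\<close>

lemma objective_diff:
  assumes adm: "admissible P" "admissible Q" and dist: "pdist Q P \<le> 2"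
    and t: "\<And>a. \<bar>err Q $ a - err P $ a\<bar> \<le> t"
    and m: "m \<ge> 0" "(norm (err P))\<^sup>2 \<le> 11 / 10 * R * m\<^sup>2" "(norm (err Q))\<^sup>2 \<le> 11 / 10 * R * m\<^sup>2"
  shows "\<bar>F Q - F P - ((norm (err Q))\<^sup>2 - (norm (err P))\<^sup>2)\<bar> \<le> 3 * (R * \<rho>) * t * m + 4 * t * s"
proof -
  define u where "u = err Q - err P"
  have "t \<ge> 0" using t by (meson abs_ge_zero order_trans)
  have P: "P \<in> perm_mats" "Q \<in> perm_mats" using adm by (auto simp: admissible_def)
  have "card {a. u $ a \<noteq> 0} \<le> pdist Q P"
    unfolding pdist_def u_def using P by (intro card_mono) (auto simp: err_nth)
  with dist have card_u: "card {a. u $ a \<noteq> 0} \<le> 2" by simp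
  have u_le: "\<bar>u $ a\<bar> \<le> t" for a using t by (simp add: u_def)
  have "(norm u)\<^sup>2 \<le> card {a. u $ a \<noteq> 0} * t\<^sup>2"
    by (rule power2_norm_le_card_support) (rule u_le)
  also have "\<dots> \<le> 2 * t\<^sup>2" using card_u by (intro mult_right_mono) auto
  finally have "\<rho> * (norm u)\<^sup>2 \<le> \<rho> * (2 * t\<^sup>2)" using rho_nonneg by (intro mult_left_mono)
  moreover have "u \<in> sparse_vecs 4" using card_u by (simp add: sparse_vecs_def)
  ultimately have Hu: "(norm (H *v u))\<^sup>2 \<le> 2 * \<rho> * t\<^sup>2" using sparse4[of u] by simp
  have Rrho: "R * \<rho> \<ge> 0" using R_ge_4 rho_nonneg by simp
  have cross: "norm (H *v u) * norm (H *v err S) \<le> 3 / 2 * (R * \<rho>) * t * m"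
    if "admissible S" "(norm (err S))\<^sup>2 \<le> 11 / 10 * R * m\<^sup>2" for S
  proof (rule power2_le_imp_le)
    have "err S \<in> sparse_vecs (2 * R)"
      using card_err_support[OF that(1)] R_ge_4 by (simp add: sparse_vecs_def)
    then have "(norm (H *v err S))\<^sup>2 \<le> R * \<rho> * (norm (err S))\<^sup>2" by (rule sparse2R)
    also have "\<dots> \<le> R * \<rho> * (11 / 10 * R * m\<^sup>2)" using that Rrho by (intro mult_left_mono)
    finally have "(norm (H *v u) * norm (H *v err S))\<^sup>2 \<le> (2 * \<rho> * t\<^sup>2) * (R * \<rho> * (11 / 10 * R * m\<^sup>2))"
      unfolding power_mult_distrib using Hu rho_nonneg by (intro mult_mono) auto
    also have "\<dots> = 11 / 5 * (R * \<rho> * t * m)\<^sup>2" by (simp add: power2_eq_square)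
    \<comment> \<open>11/5 is rounded up to 9/4, the square of 3/2.\<close>
    also have "\<dots> \<le> 9 / 4 * (R * \<rho> * t * m)\<^sup>2" by (intro mult_right_mono) auto
    also have "\<dots> = (3 / 2 * (R * \<rho>) * t * m)\<^sup>2" by (simp add: power2_eq_square)
    finally show "(norm (H *v u) * norm (H *v err S))\<^sup>2 \<le> (3 / 2 * (R * \<rho>) * t * m)\<^sup>2" .
  qed (use Rrho \<open>t \<ge> 0\<close> m in simp)
  have cross': "\<bar>(H *v u) \<bullet> (H *v err S)\<bar> \<le> 3 / 2 * (R * \<rho>) * t * m"
    if "admissible S" "(norm (err S))\<^sup>2 \<le> 11 / 10 * R * m\<^sup>2" for S
    using cross[OF that] Cauchy_Schwarz_ineq2[of "H *v u" "H *v err S"] by linarith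
  have "\<bar>u \<bullet> (Ht *v \<epsilon>)\<bar> \<le> card {a. u $ a \<noteq> 0} * (t * s)"
    using u_le s(3) by (rule abs_inner_le_card_support)
  also have "\<dots> \<le> 2 * (t * s)"
    using card_u \<open>t \<ge> 0\<close> s by (intro mult_right_mono) auto
  finally have noise: "\<bar>u \<bullet> (Ht *v \<epsilon>)\<bar> \<le> 2 * t * s" by simp
  have "F Q - F P - ((norm (err Q))\<^sup>2 - (norm (err P))\<^sup>2) =
      2 * (u \<bullet> (Ht *v \<epsilon>)) - (H *v u) \<bullet> (H *v err P) - (H *v u) \<bullet> (H *v err Q)"
    unfolding objective_expand u_def
    by (simp add: algebra_simps inner_diff_left inner_diff_right matrix_vector_mult_diff_distrib
        power2_norm_eq_inner inner_commute)
  then show ?thesis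
    using noise cross'[OF adm(1) m(2)] cross'[OF adm(2) m(3)] by linarith
qed

lemma objective_diff_coarse:
  assumes "admissible P" "Q \<in> feasible R P"
  shows "\<bar>F Q - F P - ((norm (err Q))\<^sup>2 - (norm (err P))\<^sup>2)\<bar> \<le> L\<^sup>2 / 16"
proof -
  have Q: "admissible Q" "pdist Q P \<le> 2" using assms by (auto simp: feasible_iff)
  have P: "P \<in> perm_mats" "Q \<in> perm_mats" using assms Q by (auto simp: admissible_def)
  have "\<bar>F Q - F P - ((norm (err Q))\<^sup>2 - (norm (err P))\<^sup>2)\<bar> \<le> 3 * (R * \<rho>) * U * U + 4 * U * s"
    using assms Q P UL
    by (intro objective_diff power2_norm_err_le abs_err_le) (auto simp: err_nth y_range)
  also have "3 * (R * \<rho>) * U * U \<le> 3 * (L\<^sup>2 / (90 * U\<^sup>2)) * U * U"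
    using R_rho UL by (intro mult_right_mono) auto
  also have "\<dots> = L\<^sup>2 / 30" using UL by (simp add: power2_eq_square)
  also have "4 * U * s \<le> 4 * U * (L\<^sup>2 / (160 * U))" using s UL by (intro mult_left_mono) auto
  also have "\<dots> = L\<^sup>2 / 40" using UL by simp
  also have "L\<^sup>2 / 30 + L\<^sup>2 / 40 \<le> L\<^sup>2 / 16" by (simp add: field_simps)
  finally show ?thesis by simp
qed

text \<open>Either disjunct of \<open>room\<close> makes the swap below respect the constraint at radius \<open>R\<close>: an
  error below \<open>L\<close> forces \<open>psupp Pstar \<subseteq> psupp P\<close>, so swapping two wrong entries does not
  enlarge the support.\<close>

lemma improving_swap:
  assumes adm: "admissible P" and M: "infnorm (err P) > 0"
    and room: "infnorm (err P) < L \<or> real (pdist P (mat 1)) \<le> R - 2"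
  obtains Q t where "Q \<in> feasible R P" "infnorm (err P) / 2 \<le> t"
    "\<And>a. \<bar>err Q $ a - err P $ a\<bar> \<le> t" "(norm (err Q))\<^sup>2 \<le> (norm (err P))\<^sup>2 - t * infnorm (err P)"
proof -
  define M where "M = infnorm (err P)"
  define v w where "v a = y $ perm_of P a" and "w a = y $ perm_of Pstar a" for a
  have P: "P \<in> perm_mats" using adm by (simp add: admissible_def)
  have e: "err P $ a = v a - w a" for a by (simp add: err_nth P v_def w_def)
  obtain i where i: "\<bar>v i - w i\<bar> = M" using infnorm_attained_cart[of "err P"] by (auto simp: M_def e)
  have le: "\<bar>v a - w a\<bar> \<le> M" for a
    using component_le_infnorm_cart[of "err P" a] by (simp add: M_def e)
  have bP: "bij (perm_of P)" and bS: "bij (perm_of Pstar)"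
    using bij_perm_of P Pstar by auto
  have "bij (inv (perm_of Pstar) \<circ> perm_of P)" using bP bS by (simp add: bij_comp bij_imp_bij_inv)
  moreover have "v a = w ((inv (perm_of Pstar) \<circ> perm_of P) a)" for a
    by (simp add: v_def w_def bS bij_is_surj surj_f_inv_f)
  ultimately obtain j where j: "v j \<noteq> w j" "M / 2 \<le> \<bar>v i - v j\<bar>"
    "\<bar>v i - v j\<bar> * M \<le> 2 * ((v i - v j) * (w j - w i))"
    using swap_exists[of _ v w M i] le i M M_def by metis
  define q where "q = perm_of P \<circ> Transposition.transpose i j"
  define Q where "Q = perm_mat q"
  have "bij q" using bP by (simp add: q_def bij_comp)
  then have Q: "Q \<in> perm_mats" by (simp add: Q_def perm_mat_in_perm_mats)
  have [simp]: "perm_of Q = q" by (simp add: Q_def)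
  have "i \<noteq> j" using j(2) M by (auto simp: M_def)
  have eQ: "err Q $ a = y $ q a - w a" for a by (simp add: err_nth Q w_def)
  have q_other: "q a = perm_of P a" if "a \<notin> {i, j}" for a using that by (simp add: q_def)
  have q_ij: "y $ q i = v j" "y $ q j = v i" by (simp_all add: q_def v_def)
  have dist2: "card {i, j} \<le> 2" using card_insert_le_m1[of 2 "{j}" i] by simp
  have "pdist Q P \<le> card {i, j}"
    unfolding pdist_def by (rule card_mono) (use q_other in auto)
  with dist2 have dist: "pdist Q P \<le> 2" by simp
  have "real (pdist Q (mat 1)) \<le> R"
  proof (cases "M < L")
    case True
    have "v a = w a" if "a \<notin> psupp P" for a
    proof (rule ccontr)
      assume "v a \<noteq> w a"
      moreover have "perm_of P a = a" using that by (simp add: psupp_def)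
      ultimately have "a \<in> psupp Pstar" by (auto simp: psupp_def v_def w_def)
      then have "\<bar>w a - v a\<bar> \<ge> L"
        using y_sep[of a] \<open>perm_of P a = a\<close> by (simp add: perm_mats_mult_nth Pstar v_def w_def)
      then show False using le[of a] True by linarith
    qed
    moreover have "v i \<noteq> w i" using i M by (auto simp: M_def)
    ultimately have "{i, j} \<subseteq> psupp P" using j(1) by blast
    then have "psupp Q \<subseteq> psupp P" using q_other unfolding psupp_def by fastforce
    then have "pdist Q (mat 1) \<le> pdist P (mat 1)" unfolding pdist_mat_1 by (intro card_mono) auto
    then show ?thesis using adm by (simp add: admissible_def)
  next
    case False
    then show ?thesis using room dist pdist_triangle[of Q "mat 1" P] by (simp add: M_def)
  qed
  then have "Q \<in> feasible R P" using Q dist by (simp add: feasible_iff admissible_def)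
  \<comment> \<open>The witness for \<open>t\<close> is the size of the exchanged
    difference.\<close>
  moreover have "\<bar>err Q $ a - err P $ a\<bar> \<le> \<bar>v i - v j\<bar>" for a
    using q_other[of a] q_ij by (cases "a \<in> {i, j}") (auto simp: e eQ v_def)
  moreover have "(norm (err Q))\<^sup>2 \<le> (norm (err P))\<^sup>2 - \<bar>v i - v j\<bar> * M"
  proof -
    have "(norm (err Q))\<^sup>2 - (norm (err P))\<^sup>2 = (\<Sum>a\<in>UNIV. (err Q $ a)\<^sup>2 - (err P $ a)\<^sup>2)"
      by (simp add: power2_norm_vec sum_subtractf)
    also have "\<dots> = (\<Sum>a\<in>{i, j}. (err Q $ a)\<^sup>2 - (err P $ a)\<^sup>2)"
      by (rule sum.mono_neutral_right) (use q_other in \<open>auto simp: e eQ v_def\<close>)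
    also have "\<dots> = - (2 * ((v i - v j) * (w j - w i)))"
      using \<open>i \<noteq> j\<close> by (simp add: e eQ q_ij power2_eq_square algebra_simps)
    finally show ?thesis using j(3) by linarith
  qed
  ultimately show ?thesis using that j(2) by (simp add: M_def)
qed

section \<open>One step of the local search\<close>

context
  fixes P Q
  assumes adm: "admissible P"
    and room: "infnorm (err P) < L \<or> real (pdist P (mat 1)) \<le> R - 2"
    and Q: "is_arg_min F (\<lambda>Q. Q \<in> feasible R P) Q"
begin

lemma argmin_feasible: "Q \<in> feasible R P"
  using Q by (simp add: is_arg_min_def)

lemma argmin_le: "S \<in> feasible R P \<Longrightarrow> F Q \<le> F S"
  using Q by (auto simp: is_arg_min_def not_less)

lemma argmin_energy_le: "(norm (err Q))\<^sup>2 \<le> (norm (err P))\<^sup>2 + L\<^sup>2 / 16"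
  using argmin_le[OF feasible_self[OF adm]] objective_diff_coarse[OF adm argmin_feasible] by linarith

text \<open>The minimiser is at least as good as the improving swap, which gains at least half the
  squared maximal error; passing between objective and energy costs \<open>L\<^sup>2 / 16\<close>
  for each of the two moves.\<close>

lemma argmin_energy_decrease:
  "(norm (err Q))\<^sup>2 \<le> (norm (err P))\<^sup>2 - (infnorm (err P))\<^sup>2 / 2 + L\<^sup>2 / 8"
proof (cases "infnorm (err P) > 0")
  case True
  obtain S t where S: "S \<in> feasible R P" "infnorm (err P) / 2 \<le> t"
    "(norm (err S))\<^sup>2 \<le> (norm (err P))\<^sup>2 - t * infnorm (err P)"
    using improving_swap[OF adm True room] by metis
  have "(infnorm (err P))\<^sup>2 / 2 \<le> t * infnorm (err P)"
    using mult_right_mono[OF S(2), of "infnorm (err P)"] True by (simp add: power2_eq_square)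
  then show ?thesis
    using S(3) argmin_le[OF S(1)] objective_diff_coarse[OF adm argmin_feasible]
      objective_diff_coarse[OF adm S(1)] by linarith
next
  case False
  then have "infnorm (err P) = 0" using infnorm_pos_le[of "err P"] by linarith
  moreover have "(norm (err Q))\<^sup>2 \<le> (norm (err P))\<^sup>2 + L\<^sup>2 / 8"
    using argmin_energy_le zero_le_power2[of L] by linarith
  ultimately show ?thesis by simp
qed

text \<open>A transposition keeps the sum of the two errors it touches; if moreover it does not increase
  the sum of their squares, the larger of the two moduli cannot grow.\<close>

lemma argmin_infnorm_less:
  assumes less: "infnorm (err P) < L"
  shows "infnorm (err Q) < L"
proof (rule ccontr)
  define M where "M = infnorm (err P)"
  assume "\<not> infnorm (err Q) < L"
  then obtain a where a: "\<bar>err Q $ a\<bar> \<ge> L" using infnorm_attained_cart[of "err Q"] not_less by metis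
  have le: "\<bar>err P $ b\<bar> \<le> M" for b using component_le_infnorm_cart[of "err P" b] by (simp add: M_def)
  have mats: "P \<in> perm_mats" "Q \<in> perm_mats" and dist: "pdist Q P \<le> 2"
    using adm argmin_feasible by (auto simp: feasible_iff admissible_def)
  define D where "D = {b. perm_of Q b \<noteq> perm_of P b}"
  have same: "err Q $ b = err P $ b" if "b \<notin> D" for b using that mats by (simp add: err_nth D_def)
  have neq: "err Q $ a \<noteq> err P $ a" using a le[of a] less by (auto simp: M_def)
  then have "a \<in> D" using same by blast
  then have "card (D - {a}) \<le> 1" using dist by (simp add: pdist_def D_def)
  then have eq: "b = c" if "b \<in> D - {a}" "c \<in> D - {a}" for b c
    using that by (simp add: card_le_Suc0_iff_eq)
  \<comment> \<open>\<open>b = a\<close> is allowed here; it is excluded once the error sum is known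
    to be preserved.\<close>
  obtain b where D: "D \<subseteq> {a, b}"
  proof (cases "D \<subseteq> {a}")
    case True
    then show ?thesis by (intro that[of a]) simp
  next
    case False
    then obtain b where "b \<in> D - {a}" by auto
    then have "D - {a} \<subseteq> {b}" using eq[of _ b] by (intro subsetI) simp
    then show ?thesis by (intro that[of b]) auto
  qed
  then have unmoved: "err Q $ c = err P $ c" if "c \<noteq> a" "c \<noteq> b" for c
    using that same[of c] by blast
  have sums: "(\<Sum>c\<in>UNIV. f (err Q $ c) - f (err P $ c)) =
      (\<Sum>c\<in>{a, b}. f (err Q $ c) - f (err P $ c))" for f :: "real \<Rightarrow> real"
    by (rule sum.mono_neutral_right) (use unmoved in auto)
  have zero: "(\<Sum>c\<in>{a, b}. err Q $ c - err P $ c) = 0"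
    using sums[of "\<lambda>x. x"] by (simp add: sum_subtractf sum_err mats)
  with neq have "a \<noteq> b" by auto
  define x x' z z' where xz: "x = err P $ a" "x' = err Q $ a" "z = err P $ b" "z' = err Q $ b"
  have "z' = x + z - x'" using zero \<open>a \<noteq> b\<close> by (simp add: xz)
  have "(norm (err Q))\<^sup>2 - (norm (err P))\<^sup>2 = x'\<^sup>2 - x\<^sup>2 + (z'\<^sup>2 - z\<^sup>2)"
    using sums[of "\<lambda>x. x\<^sup>2"] \<open>a \<noteq> b\<close> by (simp add: power2_norm_vec sum_subtractf xz)
  also have "\<dots> = 2 * ((x' - x) * (x' - z))"
    unfolding \<open>z' = x + z - x'\<close> by (simp add: power2_eq_square algebra_simps)
  finally have energy: "(norm (err Q))\<^sup>2 - (norm (err P))\<^sup>2 = 2 * ((x' - x) * (x' - z))" .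
  \<comment> \<open>Since \<open>x'\<close> has modulus at least \<open>L\<close> while
    \<open>x\<close> and \<open>z\<close> have modulus at most \<open>M\<close>, both factors have
    the sign of \<open>x'\<close> and size at least \<open>L - M\<close>. So the energy must
    rise.\<close>
  have "(L - M) * (L - M) \<le> \<bar>x' - x\<bar> * \<bar>x' - z\<bar>"
    using a le[of a] le[of b] less by (intro mult_mono) (auto simp: xz M_def)
  also have "\<dots> = (x' - x) * (x' - z)"
    using a le[of a] le[of b] less
    by (cases "x' \<ge> 0") (auto simp: xz M_def algebra_simps)
  finally have prod: "(L - M) * (L - M) \<le> (x' - x) * (x' - z)" .
  \<comment> \<open>For \<open>M \<ge> L / 2\<close> the swap gain outweighs the slack
    \<open>L\<^sup>2 / 8\<close>, so the energy cannot rise; for smaller \<open>M\<close> the forced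
    rise exceeds the permitted \<open>L\<^sup>2 / 16\<close>.\<close>
  show False
  proof (cases "M \<ge> L / 2")
    case True
    then have "(L / 2)\<^sup>2 \<le> M\<^sup>2" using UL by (intro power_mono) auto
    then have "(x' - x) * (x' - z) \<le> 0"
      using argmin_energy_decrease energy by (simp add: M_def power_divide)
    moreover have "(L - M) * (L - M) > 0" using less by (simp add: M_def)
    ultimately show False using prod by linarith
  next
    case False
    then have "(L / 2) * (L / 2) \<le> (L - M) * (L - M)" using UL by (intro mult_mono) auto
    then have "L\<^sup>2 / 4 \<le> (x' - x) * (x' - z)" using prod by (simp add: power2_eq_square)
    moreover have "(x' - x) * (x' - z) \<le> L\<^sup>2 / 32" using argmin_energy_le energy by simp
    moreover have "L\<^sup>2 > 0" using UL by simp
    ultimately show False by linarith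
  qed
qed

text \<open>Above \<open>36 * E\<close> the triangle inequality leaves at least 5/6 of the residual
  norm to the error. Spreading the error over at most \<open>11 / 10 * R\<close> entries makes its
  maximum \<open>M\<close> large compared with \<open>F P / R\<close>, and the improving swap gains
  a fixed fraction of \<open>M\<^sup>2\<close>.\<close>

lemma argmin_linear_decrease:
  assumes E: "E > 0" "E \<ge> 330 * R\<^sup>2 * s\<^sup>2" and large: "F P \<ge> 36 * E"
  shows "F Q \<le> (1 - 1 / (18 * R)) * F P"
proof -
  define M \<zeta> f e where defs: "M = infnorm (err P)" "\<zeta> = norm (err P)"
    "f = norm (Ht *v (err P + \<epsilon>))" "e = norm (Ht *v \<epsilon>)"
  have F: "F P = f\<^sup>2" by (simp add: objective_eq defs)
  have "(6 * e)\<^sup>2 \<le> f\<^sup>2" using large by (simp add: F defs power_mult_distrib)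
  then have "6 * e \<le> f" by (rule power2_le_imp_le) (simp add: defs)
  moreover have "norm (Ht *v err P) \<le> \<zeta>"
  proof (rule power2_le_imp_le)
    have "(norm (Ht *v err P))\<^sup>2 = \<zeta>\<^sup>2 - (norm (H *v err P))\<^sup>2"
      unfolding power2_norm_eq_inner Ht_Ht_inner defs
      by (simp add: Ht_eq inner_diff_right power2_norm_eq_inner H_inner H_H)
    then show "(norm (Ht *v err P))\<^sup>2 \<le> \<zeta>\<^sup>2" by simp
  qed (simp add: defs)
  moreover have "f \<le> norm (Ht *v err P) + e"
    unfolding defs matrix_vector_right_distrib by (rule norm_triangle_ineq)
  ultimately have "5 * e \<le> \<zeta>" "5 / 6 * f \<le> \<zeta>" by linarith+
  then have "(5 * e)\<^sup>2 \<le> \<zeta>\<^sup>2" "(5 / 6 * f)\<^sup>2 \<le> \<zeta>\<^sup>2" by (intro power_mono; simp add: defs)+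
  then have \<zeta>2: "25 * E \<le> \<zeta>\<^sup>2" "25 / 36 * f\<^sup>2 \<le> \<zeta>\<^sup>2"
    by (simp_all add: defs power_mult_distrib power_divide)
  have \<zeta>M: "\<zeta>\<^sup>2 \<le> 11 / 10 * R * M\<^sup>2"
    using power2_norm_err_le[OF adm component_le_infnorm_cart] by (simp add: defs)
  have "M \<ge> 0" by (simp add: defs infnorm_pos_le)
  moreover have "M \<noteq> 0" using \<zeta>M \<zeta>2 E by auto
  ultimately have "M > 0" by simp
  \<comment> \<open>Dividing 25 * 330 by 11/10 gives 7500; with \<open>R \<ge> 4\<close> this yields
    \<open>M \<ge> 100 * s\<close>, so the noise is negligible in the swap.\<close>
  have "25 * (330 * R\<^sup>2 * s\<^sup>2) \<le> 11 / 10 * R * M\<^sup>2" using E \<zeta>2 \<zeta>M by linarith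
  then have "R * (7500 * R * s\<^sup>2) \<le> R * M\<^sup>2" by (simp add: power2_eq_square algebra_simps)
  then have "7500 * R * s\<^sup>2 \<le> M\<^sup>2" using R_ge_4 by (simp add: mult_le_cancel_left)
  moreover have "4 * s\<^sup>2 \<le> R * s\<^sup>2" using R_ge_4 by (intro mult_right_mono) auto
  moreover have "s\<^sup>2 \<ge> 0" by simp
  moreover have "7500 * R * s\<^sup>2 = 7500 * (R * s\<^sup>2)" by simp
  ultimately have "10000 * s\<^sup>2 \<le> M\<^sup>2" by linarith
  then have "(100 * s)\<^sup>2 \<le> M\<^sup>2" by (simp add: power_mult_distrib)
  then have sM: "100 * s \<le> M" using \<open>M > 0\<close> by (auto intro: power2_le_imp_le[OF _ less_imp_le])
  obtain S t where S: "S \<in> feasible R P" "M / 2 \<le> t" "\<And>a. \<bar>err S $ a - err P $ a\<bar> \<le> t"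
    "(norm (err S))\<^sup>2 \<le> (norm (err P))\<^sup>2 - t * M"
    using improving_swap[OF adm _ room] \<open>M > 0\<close> unfolding defs by metis
  have "t > 0" using S(2) \<open>M > 0\<close> by linarith
  then have "t * M > 0" using \<open>M > 0\<close> by simp
  have "\<bar>F S - F P - ((norm (err S))\<^sup>2 - (norm (err P))\<^sup>2)\<bar> \<le> 3 * (R * \<rho>) * t * M + 4 * t * s"
  proof (rule objective_diff)
    show "(norm (err S))\<^sup>2 \<le> 11 / 10 * R * M\<^sup>2"
      using S(4) \<zeta>M \<open>t * M > 0\<close> unfolding defs by linarith
  qed (use S adm \<zeta>M \<open>M > 0\<close> in \<open>auto simp: feasible_iff defs\<close>)
  moreover have "3 * (R * \<rho>) * t * M \<le> t * M / 30"
  proof -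
    have "L\<^sup>2 \<le> U\<^sup>2" using UL by (intro power_mono) auto
    then have "L\<^sup>2 / (90 * U\<^sup>2) \<le> 1 / 90" using UL by (simp add: divide_simps)
    then have "R * \<rho> \<le> 1 / 90" using R_rho by linarith
    then show ?thesis using mult_right_mono[of "R * \<rho>" "1 / 90" "t * M"] \<open>t * M > 0\<close> by simp
  qed
  moreover have "4 * t * s \<le> t * M / 25"
    using mult_left_mono[OF sM, of t] \<open>t > 0\<close> by simp
  \<comment> \<open>The relative losses 1/30 and 1/25 add up to less than 1/10.\<close>
  ultimately have "F S \<le> F P - 9 / 10 * (t * M)" using S(4) \<open>t * M > 0\<close> by linarith
  moreover have "M\<^sup>2 / 2 \<le> t * M"
    using mult_right_mono[OF S(2), of M] \<open>M > 0\<close> by (simp add: power2_eq_square)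
  moreover have "f\<^sup>2 / (18 * R) \<le> 9 / 20 * M\<^sup>2"
  proof -
    have "f\<^sup>2 \<le> 9 / 20 * 18 * R * M\<^sup>2"
    proof -
      have "f\<^sup>2 \<le> 36 / 25 * (11 / 10 * R * M\<^sup>2)" using \<zeta>2 \<zeta>M by linarith
      moreover have "0 \<le> R * M\<^sup>2" using R_ge_4 by simp
      ultimately show ?thesis by simp
    qed
    then show ?thesis using R_ge_4 by (simp add: field_simps)
  qed
  ultimately have "F S \<le> F P - F P / (18 * R)" unfolding F by linarith
  then show ?thesis using argmin_le[OF S(1)] by (simp add: algebra_simps)
qed

end

section \<open>The iterates and the radius constraint\<close>

context
  fixes P
  assumes alg: "local_search_seq X y R P"
begin

lemma iterate_0: "P 0 = mat 1"
  using alg by (simp add: local_search_seq_def)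

lemma iterate_Suc: "is_arg_min F (\<lambda>Q. Q \<in> feasible R (P k)) (P (Suc k))"
  using alg by (simp add: local_search_seq_def)

lemma iterate_admissible: "admissible (P k)"
proof (cases k)
  case 0
  then show ?thesis using R_ge_4
    by (simp add: iterate_0 admissible_def mat_1_eq_perm_mat perm_mat_in_perm_mats pdist_def)
next
  case (Suc l)
  then show ?thesis using iterate_Suc[of l] by (auto simp: is_arg_min_def feasible_iff)
qed

lemma iterate_feasible: "P (Suc k) \<in> feasible R (P k)"
  using iterate_Suc[of k] by (simp add: is_arg_min_def)

lemma pdist_iterate: "pdist (P k) (mat 1) \<le> 2 * k"
proof (induction k)
  case 0
  then show ?case by (simp add: iterate_0 pdist_def)
next
  case (Suc k)
  then show ?case
    using pdist_triangle[of "P (Suc k)" "mat 1" "P k"] iterate_feasible[of k]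
    by (simp add: feasible_iff)
qed

text \<open>The hypothesis says that \<open>k\<close> steps each used
  \<open>3 / 8 * L\<^sup>2\<close> of an energy budget \<open>real r * U\<^sup>2\<close>. This
  bounds \<open>k\<close>, and each step moves by distance at most 2; the factor 10 in
  \<open>R_ge\<close> exceeds the required 16/3.\<close>

lemma iterate_room_aux:
  assumes "3 / 8 * L\<^sup>2 * real k \<le> real r * U\<^sup>2 - (norm (err (P k)))\<^sup>2"
  shows "real (pdist (P k) (mat 1)) \<le> R - 2"
proof -
  have "3 / 8 * L\<^sup>2 * real k \<le> real r * U\<^sup>2" using assms by (smt (verit) zero_le_power2)
  then have "real k \<le> 8 / 3 * (real r * U\<^sup>2 / L\<^sup>2)" using UL by (simp add: field_simps)
  moreover define x where "x = real r * U\<^sup>2 / L\<^sup>2"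
  ultimately have "real k \<le> 8 / 3 * x" by simp
  moreover have "x \<ge> 0" by (simp add: x_def)
  moreover have "R \<ge> 10 * x + 4" using R_ge by (simp add: x_def mult.assoc)
  ultimately have "2 * real k \<le> R - 4" by linarith
  then show ?thesis using pdist_iterate[of k] by linarith
qed

text \<open>While the maximal error is at least \<open>L\<close>, each step uses
  \<open>1/2 - 1/8 = 3/8\<close> of \<open>L\<^sup>2\<close> from the budget; once it is below
  \<open>L\<close>, it stays there. Either alternative supplies the room needed for the next
  step.\<close>

lemma iterate_invariant:
  "infnorm (err (P k)) < L \<or> 3 / 8 * L\<^sup>2 * real k \<le> real r * U\<^sup>2 - (norm (err (P k)))\<^sup>2"
proof (induction k)
  case 0
  have mat1: "mat 1 \<in> perm_mats" by (simp add: mat_1_eq_perm_mat perm_mat_in_perm_mats)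
  have "(norm (err (mat 1)))\<^sup>2 \<le> card {a. err (mat 1) $ a \<noteq> 0} * U\<^sup>2"
    by (rule power2_norm_le_card_support) (simp add: abs_err_le mat1)
  also have "card {a. err (mat 1) $ a \<noteq> 0} \<le> pdist Pstar (mat 1)"
    unfolding pdist_def by (intro card_mono) (auto simp: err_nth mat1)
  also have "\<dots> \<le> r" by (rule Pstar)
  finally show ?case by (simp add: iterate_0 mult_right_mono)
next
  case (Suc k)
  then have room: "infnorm (err (P k)) < L \<or> real (pdist (P k) (mat 1)) \<le> R - 2"
    using iterate_room_aux by blast
  show ?case
  proof (cases "infnorm (err (P k)) < L")
    case True
    then show ?thesis using argmin_infnorm_less[OF iterate_admissible room iterate_Suc] by blast
  next
    case False
    then have "L\<^sup>2 \<le> (infnorm (err (P k)))\<^sup>2" using UL by (intro power_mono) auto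
    then have "(norm (err (P (Suc k))))\<^sup>2 \<le> (norm (err (P k)))\<^sup>2 - 3 / 8 * L\<^sup>2"
      using argmin_energy_decrease[OF iterate_admissible room iterate_Suc] by linarith
    moreover have "3 / 8 * L\<^sup>2 * real k \<le> real r * U\<^sup>2 - (norm (err (P k)))\<^sup>2"
      using Suc False by blast
    moreover have "3 / 8 * L\<^sup>2 * real (Suc k) = 3 / 8 * L\<^sup>2 * real k + 3 / 8 * L\<^sup>2"
      by (simp add: algebra_simps)
    ultimately show ?thesis by linarith
  qed
qed

lemma iterate_room: "infnorm (err (P k)) < L \<or> real (pdist (P k) (mat 1)) \<le> R - 2"
  using iterate_invariant iterate_room_aux by blast

lemma iterate_gap: "gap X y R (P k) = F (P k) - F (P (Suc k))"
proof -
  have "finite (feasible R (P k))"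
    using finite_perm_mats by (rule finite_subset[rotated]) (auto simp: feasible_def)
  then have "Min (F ` feasible R (P k)) = F (P (Suc k))"
    using iterate_Suc[of k] by (intro Min_eqI) (auto simp: is_arg_min_def not_less)
  then show ?thesis by (simp add: gap_def)
qed

lemma iterate_antimono: "F (P (Suc k)) \<le> F (P k)"
  using argmin_le[OF iterate_admissible iterate_room iterate_Suc feasible_self[OF iterate_admissible]] .

text \<open>The iterates take finitely many values, so some iterate attains the least objective of
  the sequence and the step after it gains nothing. This serves the case of an infinite iteration
  count.\<close>

lemma iterate_gap_eventually_0: "\<exists>k. gap X y R (P k) \<le> 0"
proof -
  have "range P \<subseteq> perm_mats" using iterate_admissible by (auto simp: admissible_def)
  then have "finite (range P)" using finite_perm_mats by (rule finite_subset)
  then have fin: "finite (range (\<lambda>k. F (P k)))"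
    by (metis finite_imageI image_image)
  define m where "m = Min (range (\<lambda>k. F (P k)))"
  have "m \<in> range (\<lambda>k. F (P k))" unfolding m_def using fin by (intro Min_in) auto
  then obtain k where "m = F (P k)" by auto
  moreover have "m \<le> F (P (Suc k))" unfolding m_def using fin by (intro Min_le) auto
  ultimately show ?thesis by (intro exI[of _ k]) (simp add: iterate_gap)
qed

theorem gap_le_within_K_dagger:
  assumes E: "E \<ge> 330 * R\<^sup>2 * s\<^sup>2" and c: "c > 0"
  shows "\<exists>k. enat k \<le> K_dagger X y \<epsilon> (P 0) R c \<and> gap X y R (P k) \<le> c * s\<^sup>2"
proof (cases "Ht *v \<epsilon> = 0")
  case True
  moreover have "0 \<le> c * s\<^sup>2" using c by simp
  ultimately show ?thesis using iterate_gap_eventually_0 by (auto simp: K_dagger_def intro: order_trans)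
next
  case False
  then have "E > 0" by simp
  have "E \<le> card {a. (Ht *v \<epsilon>) $ a \<noteq> 0} * s\<^sup>2"
    by (rule power2_norm_le_card_support) (rule order_trans[OF component_le_infnorm_cart s(3)])
  also have "\<dots> \<le> real CARD('n) * s\<^sup>2" by (intro mult_right_mono) (auto intro: card_mono)
  finally have "E \<le> real CARD('n) * s\<^sup>2" .
  moreover have "0 < 1 - 1 / (18 * R)" "1 - 1 / (18 * R) < 1" using R_ge_4 by (auto simp: field_simps)
  moreover have "F (P (Suc k)) \<le> (1 - 1 / (18 * R)) * F (P k)" if "F (P k) \<ge> 36 * E" for k
    using \<open>E > 0\<close> E that by (rule argmin_linear_decrease[OF iterate_admissible iterate_room iterate_Suc])
  ultimately obtain k where
    "k \<le> nat (\<lceil>max 0 (ln (36 * E / F (P 0)) / ln (1 - 1 / (18 * R))) + 72 * real CARD('n) / c\<rceil> + 1)"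
    "F (P k) - F (P (Suc k)) \<le> c * s\<^sup>2"
    using descent_count[of "\<lambda>k. F (P k)" E "real CARD('n)" "s\<^sup>2" c "1 - 1 / (18 * R)"]
      \<open>E > 0\<close> c iterate_antimono by (auto simp: objective_def)
  then show ?thesis using False by (auto simp: K_dagger_def iterate_gap objective_def)
qed

end

end

section \<open>Reduction of the stated hypotheses to the locale\<close>

theorem theorem3p9:
  fixes X :: "real^'d^'n" and y \<epsilon> :: "real^'n" and \<beta> :: "real^'d"
    and Pstar :: "real^'n^'n" and r :: nat
    and U L R C1 \<rho> C \<sigma>bar \<sigma> c :: real
    and P :: "nat \<Rightarrow> real^'n^'n"
  assumes dims: "CARD('n) > CARD('d)"
    and full_rank: "rank X = CARD('d)"
    and Pstar: "Pstar \<in> perm_mats" "pdist Pstar (mat 1) \<le> r"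
    and model: "Pstar *v y = X *v \<beta> + \<epsilon>"
    and A1: "U > L" "L > 0"
      "\<forall>i j. \<bar>y $ i - y $ j\<bar> \<le> U"
      "\<forall>i \<in> psupp Pstar. \<bar>(Pstar *v y) $ i - y $ i\<bar> \<ge> L"
    and A2: "C1 > 1" "R = 10 * C1 * real r * U\<^sup>2 / L\<^sup>2 + 4"
    and A3: "\<rho> \<le> C * (real CARD('d) * ln (real CARD('n)) / real CARD('n))"
      "R * \<rho> \<le> L\<^sup>2 / (90 * U\<^sup>2)"
      "\<forall>u \<in> sparse_vecs 4. (norm (hat_mat X *v u))\<^sup>2 \<le> \<rho> * (norm u)\<^sup>2"
      "\<forall>u \<in> sparse_vecs (2 * R). (norm (hat_mat X *v u))\<^sup>2 \<le> R * \<rho> * (norm u)\<^sup>2"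
    and A4: "\<sigma>bar \<ge> 0"
      "\<sigma>bar \<le> min (1/2) ((\<rho> * real CARD('d)) powr (-1/2)) * (L\<^sup>2 / (80 * U))"
      "infnorm (resid_mat X *v \<epsilon>) \<le> \<sigma>bar"
      "infnorm \<epsilon> \<le> \<sigma>bar"
      "norm (hat_mat X *v \<epsilon>) \<le> sqrt (real CARD('d)) * \<sigma>bar"
    and B1: "R\<^sup>2 * \<rho> \<le> 1/10"
    and B2: "\<sigma> \<ge> 0"
      "\<sigma>bar\<^sup>2 \<le> \<sigma>\<^sup>2 * min (real CARD('n) / (660 * R\<^sup>2))
                            (real CARD('n) / (5 * real CARD('d) * R))"
      "(norm (resid_mat X *v \<epsilon>))\<^sup>2 \<ge> 1/2 * real CARD('n) * \<sigma>\<^sup>2"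
    and alg: "local_search_seq X y R P"
    and c: "c > 0"
  shows "\<exists>k. enat k \<le> K_dagger X y \<epsilon> (P 0) R c \<and> gap X y R (P k) \<le> c * \<sigma>bar\<^sup>2"
proof -
  have "1 * (real r * U\<^sup>2 / L\<^sup>2) \<le> C1 * (real r * U\<^sup>2 / L\<^sup>2)"
    using A2(1) by (intro mult_right_mono) auto
  then have R: "R \<ge> 10 * real r * U\<^sup>2 / L\<^sup>2 + 4" using A2(2) by simp
  have "\<sigma>bar \<le> 1 / 2 * (L\<^sup>2 / (80 * U))"
    using A1 by (intro order_trans[OF A4(2)] mult_right_mono) auto
  then interpret mismatched_regression X y \<epsilon> \<beta> Pstar r U L R \<rho> \<sigma>bar
    using assms R by unfold_locales auto
  have "R > 0" using R_ge_4 by simp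
  \<comment> \<open>The first entry of the minimum in \<open>B2\<close> is used; half of 660 gives
    the 330 of the linear phase.\<close>
  have "\<sigma>bar\<^sup>2 \<le> \<sigma>\<^sup>2 * (real CARD('n) / (660 * R\<^sup>2))"
    by (intro order_trans[OF B2(2)] mult_left_mono) auto
  then have "330 * R\<^sup>2 * \<sigma>bar\<^sup>2 \<le> 1/2 * real CARD('n) * \<sigma>\<^sup>2"
    using \<open>R > 0\<close> by (simp add: field_simps)
  then show ?thesis
    using B2(3) by (intro gap_le_within_K_dagger[OF alg _ c]) linarith
qed

end
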